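(* For $K=\mathbb{R}$ with the trivial absolute value and the vector space $(\mathbb{R}^{n+1})^*$, there is a homeomorphism $$\mathfrak{R}\mathcal{X}_n(\mathbb{R})\cong\Sigma^*_{\mathcal{M}_{\mathrm{univ}}}$$ between the signed Goldman–Iwahori space and the real Bergman fan of the universal realizable oriented matroid $\mathcal{M}_{\mathrm{univ}}$ on the ground set $(\mathbb{R}^{n+1})^*$.
   Context: Signed Goldman–Iwahori space. The trivial absolute value on $\mathbb{R}$ is $|0|=0$, $|\lambda|=1$ for $\lambda\ne0$. A signed seminorm on a finite-dimensional real vector space $W$ is a map $\|\cdot\|^{\mathrm{sgn}}\colon W\to\mathbb{R}$ with $\|\lambda v\|^{\mathrm{sgn}}=\mathrm{sgn}(\lambda)|\lambda|\,\|v\|^{\mathrm{sgn}}$ and $\min(\|v\|^{\mathrm{sgn}},\|w\|^{\mathrm{sgn}})\le\|v+w\|^{\mathrm{sgn}}\le\max(\|v\|^{\mathrm{sgn}},\|w\|^{\mathrm{sgn}})$ for all $\lambda\in\mathbb{R}$, $v,w\in W$. $\mathfrak{R}\mathcal{X}_n(\mathbb{R})$ is the set of not identically zero signed seminorms on $E=(\mathbb{R}^{n+1})^*$ modulo multiplication by constants in $\mathbb{R}\setminus\{0\}$, with the quotient of the topology of pointwise convergence. Universal oriented matroid. $\mathcal{M}_{\mathrm{univ}}$ is the oriented matroid of rank $n+1$ on $E=(\mathbb{R}^{n+1})^*$ with chirotope $\varphi\colon E^{n+1}\to\{0,+1,-1\}$, $(f_0,\dots,f_n)\mapsto\mathrm{sgn}(\det[f_0,\dots,f_n])$.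 Its signed cocircuits are the not identically zero maps $E\to\{0,+1,-1\}$ of the form $e\mapsto\pm\varphi(\mu_1,\dots,\mu_n,e)$ with $(\mu_1,\dots,\mu_n)\in E^n$. For $C,C'\colon E\to\{0,+1,-1\}$ the composition is $(C\circ C')(e)=C(e)$ if $C(e)\ne0$ and $(C\circ C')(e)=C'(e)$ if $C(e)=0$. Covectors are finite compositions of signed cocircuits (including the zero map). Covectors are partially ordered by the coordinatewise order induced by $0<+1$, $0<-1$ (with $+1,-1$ incomparable). Real Bergman fan. Let $\mathbb{RP}^E=(\mathbb{R}^E\setminus\{0\})/\mathbb{R}^*$ with the topology of pointwise convergence. $\Sigma^*_{\mathcal{M}_{\mathrm{univ}}}\subset\mathbb{RP}^E$ is the union of the (images of the) cones $\langle X_1,\dots,X_l\rangle_{\mathbb{R}_{>0}}=\{\sum_i\alpha_iX_i\mid\alpha_i>0\}$ over all chains $X_1<\dots<X_l$ of non-zero covectors (viewed as vectors in $\mathbb{R}^E$), with the subspace topology. *)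

theory Defs
  imports "HOL-Analysis.Analysis"
begin

section \<open>Projective quotients\<close>

text \<open>
  The finest topology on \<open>topspace X // r\<close> for which \<open>x \<mapsto> r `` {x}\<close> is continuous.
\<close>

definition quotient_topology :: "'a topology \<Rightarrow> ('a \<times> 'a) set \<Rightarrow> 'a set topology" where
  "quotient_topology X r =
     topology (\<lambda>U. U \<subseteq> topspace X // r \<and> openin X {x \<in> topspace X. r `` {x} \<in> U})"

lemma openin_quotient_topology:
  "openin (quotient_topology X r) U \<longleftrightarrow>
     U \<subseteq> topspace X // r \<and> openin X {x \<in> topspace X. r `` {x} \<in> U}"
proof -
  have "istopology (\<lambda>U. U \<subseteq> topspace X // r \<and> openin X {x \<in> topspace X. r `` {x} \<in> U})"
    unfolding istopology_def
  proof (intro conjI allI impI)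
    fix S T
    assume S: "S \<subseteq> topspace X // r \<and> openin X {x \<in> topspace X. r `` {x} \<in> S}"
      and T: "T \<subseteq> topspace X // r \<and> openin X {x \<in> topspace X. r `` {x} \<in> T}"
    have "{x \<in> topspace X. r `` {x} \<in> S \<inter> T} =
        {x \<in> topspace X. r `` {x} \<in> S} \<inter> {x \<in> topspace X. r `` {x} \<in> T}"
      by auto
    then show "openin X {x \<in> topspace X. r `` {x} \<in> S \<inter> T}"
      using S T by (simp add: openin_Int)
    show "S \<inter> T \<subseteq> topspace X // r"
      using S by blast
  next
    fix K
    assume K: "\<forall>S\<in>K. S \<subseteq> topspace X // r \<and> openin X {x \<in> topspace X. r `` {x} \<in> S}"
    have "{x \<in> topspace X. r `` {x} \<in> \<Union>K} = (\<Union>S\<in>K. {x \<in> topspace X. r `` {x} \<in> S})"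
      by auto
    then show "openin X {x \<in> topspace X. r `` {x} \<in> \<Union>K}"
      using K by auto
    show "\<Union>K \<subseteq> topspace X // r"
      using K by blast
  qed
  then show ?thesis
    by (simp add: quotient_topology_def topology_inverse')
qed

lemma topspace_quotient_topology: "topspace (quotient_topology X r) = topspace X // r"
proof (rule antisym)
  show "topspace (quotient_topology X r) \<subseteq> topspace X // r"
    using openin_quotient_topology[of X r "topspace (quotient_topology X r)"] by simp
  have "{x \<in> topspace X. r `` {x} \<in> topspace X // r} = topspace X"
    by (auto simp: quotientI)
  then have "openin (quotient_topology X r) (topspace X // r)"
    by (simp add: openin_quotient_topology)
  then show "topspace X // r \<subseteq> topspace (quotient_topology X r)"
    by (rule openin_subset)
qed

lemma quotient_map_quotient_topology:
  "quotient_map X (quotient_topology X r) (\<lambda>x. r `` {x})"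
  by (auto simp: quotient_map_def topspace_quotient_topology openin_quotient_topology quotient_def)

definition scaling_rel :: "('e \<Rightarrow> real) set \<Rightarrow> (('e \<Rightarrow> real) \<times> ('e \<Rightarrow> real)) set" where
  "scaling_rel S = {(x, y). x \<in> S \<and> y \<in> S \<and> (\<exists>c. c \<noteq> 0 \<and> y = (\<lambda>e. c * x e))}"

lemma equiv_scaling_rel: "equiv S (scaling_rel S)"
proof (rule equivI)
  show "scaling_rel S \<subseteq> S \<times> S"
    by (auto simp: scaling_rel_def)
  show "refl_on S (scaling_rel S)"
    by (auto simp: refl_on_def scaling_rel_def intro!: exI[of _ 1])
  show "sym (scaling_rel S)"
  proof (rule symI)
    fix x y assume "(x, y) \<in> scaling_rel S"
    then obtain c where c: "x \<in> S" "y \<in> S" "c \<noteq> 0" "y = (\<lambda>e. c * x e)"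
      by (auto simp: scaling_rel_def)
    then have "x = (\<lambda>e. inverse c * y e)" "inverse c \<noteq> 0"
      by auto
    with c(1,2) show "(y, x) \<in> scaling_rel S"
      unfolding scaling_rel_def by blast
  qed
  show "trans (scaling_rel S)"
  proof (rule transI)
    fix x y z assume "(x, y) \<in> scaling_rel S" "(y, z) \<in> scaling_rel S"
    then obtain c d where c: "x \<in> S" "z \<in> S" "c \<noteq> 0" "d \<noteq> 0"
      "y = (\<lambda>e. c * x e)" "z = (\<lambda>e. d * y e)"
      by (auto simp: scaling_rel_def)
    then have "z = (\<lambda>e. (d * c) * x e)" "d * c \<noteq> 0"
      by (auto simp: mult.assoc)
    with c(1,2) show "(x, z) \<in> scaling_rel S"
      unfolding scaling_rel_def by blast
  qed
qed

definition nonzero_vectors :: "('e \<Rightarrow> real) set" where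
  "nonzero_vectors = {x. x \<noteq> (\<lambda>_. 0)}"

definition real_projective_space :: "('e \<Rightarrow> real) set topology" where
  "real_projective_space =
     quotient_topology (subtopology (powertop_real UNIV) nonzero_vectors) (scaling_rel nonzero_vectors)"


section \<open>The signed Goldman--Iwahori space\<close>

definition trivial_abs :: "real \<Rightarrow> real" where
  "trivial_abs a = (if a = 0 then 0 else 1)"

definition signed_seminorm :: "('w::real_vector \<Rightarrow> real) \<Rightarrow> bool" where
  "signed_seminorm s \<longleftrightarrow>
     (\<forall>a v. s (a *\<^sub>R v) = sgn a * trivial_abs a * s v) \<and>
     (\<forall>v w. min (s v) (s w) \<le> s (v + w) \<and> s (v + w) \<le> max (s v) (s w))"

definition nonzero_signed_seminorms :: "('w::real_vector \<Rightarrow> real) set" where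
  "nonzero_signed_seminorms = {s. signed_seminorm s \<and> s \<noteq> (\<lambda>_. 0)}"

definition signed_goldman_iwahori_space :: "('w::real_vector \<Rightarrow> real) set topology" where
  "signed_goldman_iwahori_space =
     quotient_topology (subtopology (powertop_real UNIV) nonzero_signed_seminorms)
       (scaling_rel nonzero_signed_seminorms)"


section \<open>Cocircuits, covectors and the real Bergman fan\<close>

text \<open>
  An oriented matroid of rank \<open>CARD('n)\<close> on the ground set \<open>UNIV :: 'e set\<close> is given by its
  chirotope \<open>\<phi>\<close>, where a tuple \<open>(e\<^sub>0, \<dots>, e\<^sub>n)\<close> of ground set elements is a function on a
  finite linearly ordered index type \<open>'n\<close> with \<open>n + 1\<close> elements. Signs are the real numbers
  \<open>0\<close>, \<open>1\<close>, \<open>-1\<close>, so that sign vectors are elements of the space of functions \<open>'e \<Rightarrow> real\<close>.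
\<close>

text \<open>
  The value of \<open>\<mu>\<close> at the last index is overwritten by \<open>e\<close>, so \<open>\<mu>\<close> plays the role of a tuple
  \<open>(\<mu>\<^sub>1, \<dots>, \<mu>\<^sub>n)\<close>.
\<close>

definition signed_cocircuits ::
  "(('n::{finite,linorder} \<Rightarrow> 'e) \<Rightarrow> real) \<Rightarrow> ('e \<Rightarrow> real) set" where
  "signed_cocircuits \<phi> =
     {C. C \<noteq> (\<lambda>_. 0) \<and>
         (\<exists>\<mu>. C = (\<lambda>e. \<phi> (\<mu>(Max UNIV := e))) \<or> C = (\<lambda>e. - \<phi> (\<mu>(Max UNIV := e))))}"

definition sign_comp :: "('e \<Rightarrow> real) \<Rightarrow> ('e \<Rightarrow> real) \<Rightarrow> 'e \<Rightarrow> real" where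
  "sign_comp C D = (\<lambda>e. if C e \<noteq> 0 then C e else D e)"

text \<open>The empty composition is the zero covector.\<close>

definition covectors ::
  "(('n::{finite,linorder} \<Rightarrow> 'e) \<Rightarrow> real) \<Rightarrow> ('e \<Rightarrow> real) set" where
  "covectors \<phi> = {foldr sign_comp Cs (\<lambda>_. 0) | Cs. set Cs \<subseteq> signed_cocircuits \<phi>}"

text \<open>
  On sign vectors this is the coordinatewise strict order induced by \<open>0 < 1\<close> and \<open>0 < -1\<close>,
  not the usual order of real-valued functions.
\<close>

definition sign_less :: "('e \<Rightarrow> real) \<Rightarrow> ('e \<Rightarrow> real) \<Rightarrow> bool" where
  "sign_less X Y \<longleftrightarrow> (\<forall>e. X e = 0 \<or> X e = Y e) \<and> X \<noteq> Y"

definition open_cone :: "('e \<Rightarrow> real) list \<Rightarrow> ('e \<Rightarrow> real) set" where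
  "open_cone Xs =
     {(\<lambda>e. \<Sum>i<length Xs. \<alpha> i * (Xs ! i) e) | \<alpha>. \<forall>i<length Xs. \<alpha> i > 0}"

definition real_bergman_set ::
  "(('n::{finite,linorder} \<Rightarrow> 'e) \<Rightarrow> real) \<Rightarrow> ('e \<Rightarrow> real) set set" where
  "real_bergman_set \<phi> =
     (\<Union>Xs \<in> {Xs. Xs \<noteq> [] \<and> set Xs \<subseteq> covectors \<phi> - {\<lambda>_. 0} \<and> sorted_wrt sign_less Xs}.
        (\<lambda>x. scaling_rel nonzero_vectors `` {x}) ` open_cone Xs)"

definition real_bergman_fan ::
  "(('n::{finite,linorder} \<Rightarrow> 'e) \<Rightarrow> real) \<Rightarrow> ('e \<Rightarrow> real) set topology" where
  "real_bergman_fan \<phi> = subtopology real_projective_space (real_bergman_set \<phi>)"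


section \<open>The universal realizable oriented matroid\<close>

text \<open>
  The dual of the space \<open>real ^ 'n\<close>; every linear functional on it is bounded.
\<close>

type_synonym 'n dual = "(real ^ 'n) \<Rightarrow>\<^sub>L real"

text \<open>
  The columns of the matrix are the coordinate vectors of the functionals with respect to the
  basis dual to the standard basis.
\<close>

definition universal_chirotope :: "('n::{finite,linorder} \<Rightarrow> 'n dual) \<Rightarrow> real" where
  "universal_chirotope f = sgn (det (\<chi> i j. blinfun_apply (f j) (axis i 1)))"

end

theory Submission
  imports Defs
begin

text \<open>
  The homeomorphism is the identity: both sides are the image in real projective space of the same
  set of functions \<open>E \<rightarrow> \<real>\<close>, because the nonzero signed seminorms are exactly the elements of the
  open cones over chains of nonzero covectors.

  \<^item> A cocircuit is a signed seminorm, being the sign of a linear functional on \<open>E\<close>, and composition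
    of sign vectors preserves signed seminorms, so covectors are signed seminorms with values in
    \<open>{-1, 0, 1}\<close>. The members of a chain of covectors are pairwise comonotone: no two points of \<open>E\<close>
    are ordered oppositely by two of them. For comonotone signed seminorms the inequalities add up
    (\<open>signed_seminorm_comonotone_sum\<close>), so each point of a cone is a signed seminorm.

  \<^item> Conversely, the sublevel sets of \<open>\<bar>s\<bar>\<close> are subspaces of \<open>E\<close>, so a signed seminorm \<open>s\<close> attains only
    finitely many absolute values \<open>d\<^sub>0 > \<dots> > d\<^sub>n = 0\<close>. Keeping the sign of \<open>s\<close> where
    \<open>\<bar>s\<bar> \<ge> d\<^sub>i\<close> and putting \<open>0\<close> elsewhere gives an increasing chain of sign-valued seminorms \<open>X\<^sub>i\<close>, and
    \<open>s = (\<Sum>i<n. (d\<^sub>i - d\<^sub>i\<^sub>+\<^sub>1) X\<^sub>i)\<close> telescopes.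

  \<^item> It remains to see that every sign-valued seminorm \<open>X\<close> is a covector. A hyperplane that separates
    the convex set \<open>{X > 0}\<close> from \<open>0\<close> yields a functional whose sign agrees with \<open>X\<close> wherever the
    functional does not vanish; on its kernel one repeats the argument. Thus \<open>X\<close> is a lexicographic
    sign (\<open>sign_valued_seminorm_lexicographic_on\<close>), that is, a composition of signs of nonzero functionals, and
    by Cramer's rule each of these is a cocircuit (\<open>sgn_inner_signed_cocircuit\<close>).

  For the topologies, the projection to projective space is open, and the set of nonzero signed
  seminorms is saturated for it. Hence forming the quotient commutes with restricting to this set
  (\<open>quotient_topology_scaling_saturated\<close>).
\<close>

section \<open>Signed seminorms\<close>

lemma signed_seminorm_scaleR: "signed_seminorm s \<Longrightarrow> s (a *\<^sub>R v) = sgn a * s v"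
  by (simp add: signed_seminorm_def trivial_abs_def)

lemma signed_seminorm_minus: "signed_seminorm s \<Longrightarrow> s (- v) = - s v"
  using signed_seminorm_scaleR[of s "-1" v] by simp

lemma signed_seminorm_zero: "signed_seminorm s \<Longrightarrow> s 0 = 0"
  using signed_seminorm_scaleR[of s 0 0] by simp

lemma signed_seminorm_add_le: "signed_seminorm s \<Longrightarrow> s (v + w) \<le> max (s v) (s w)"
  by (simp add: signed_seminorm_def)

lemma signed_seminorm_add_ge: "signed_seminorm s \<Longrightarrow> min (s v) (s w) \<le> s (v + w)"
  by (simp add: signed_seminorm_def)

text \<open>By oddness the upper bound, applied to \<open>- v\<close> and \<open>- w\<close>, gives the lower bound.\<close>

lemma signed_seminormI:
  assumes scale: "\<And>a v. s (a *\<^sub>R v) = sgn a * s v"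
    and add: "\<And>v w. s (v + w) \<le> max (s v) (s w)"
  shows "signed_seminorm s"
proof -
  have neg: "s (- v) = - s v" for v
    using scale[of "-1" v] by simp
  have "min (s v) (s w) \<le> s (v + w)" for v w
    using add[of "- v" "- w"] neg[of v] neg[of w] neg[of "v + w"] by simp
  moreover have "sgn a * trivial_abs a = sgn a" for a :: real
    by (simp add: trivial_abs_def)
  ultimately show ?thesis
    using assms by (simp add: signed_seminorm_def)
qed

lemma signed_seminorm_odd_mono:
  assumes s: "signed_seminorm s" and f: "mono f" and odd: "\<And>r. f (- r) = - f r"
  shows "signed_seminorm (\<lambda>v. f (s v :: real) :: real)"
proof (rule signed_seminormI)
  have "f 0 = 0"
    using odd[of 0] by simp
  then show "f (s (a *\<^sub>R v)) = sgn a * f (s v)" for a v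
    by (simp add: signed_seminorm_scaleR[OF s] sgn_if odd)
  show "f (s (v + w)) \<le> max (f (s v)) (f (s w))" for v w
    using monoD[OF f signed_seminorm_add_le[OF s, of v w]] by (simp add: max_def split: if_splits)
qed

lemma signed_seminorm_scale:
  assumes s: "signed_seminorm s"
  shows "signed_seminorm (\<lambda>v. c * s v)"
proof (rule signed_seminormI)
  show "c * s (a *\<^sub>R v) = sgn a * (c * s v)" for a v
    by (simp add: signed_seminorm_scaleR[OF s])
  show "c * s (v + w) \<le> max (c * s v) (c * s w)" for v w
    using signed_seminorm_add_le[OF s, of v w] signed_seminorm_add_ge[OF s, of v w]
      mult_left_mono[of "s (v + w)" _ c] mult_left_mono_neg[of _ "s (v + w)" c]
    unfolding le_max_iff_disj min_le_iff_disj by (meson linorder_linear)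
qed

lemma signed_seminorm_compose_linear:
  assumes s: "signed_seminorm s" and g: "linear g"
  shows "signed_seminorm (\<lambda>v. s (g v))"
  using s by (intro signed_seminormI)
    (simp_all add: linear_cmul[OF g] linear_add[OF g] signed_seminorm_scaleR signed_seminorm_add_le)

lemma sgn_real_values: "sgn r = -1 \<or> sgn r = 0 \<or> sgn r = 1" for r :: real
  by (simp add: sgn_if)

lemma signed_seminorm_sgn: "signed_seminorm (sgn :: real \<Rightarrow> real)"
  by (rule signed_seminormI) (simp_all add: sgn_mult, simp add: sgn_if)

text \<open>
  Comonotonicity makes one of \<open>v\<close>, \<open>w\<close> dominate the other simultaneously for all \<open>X i\<close>, so the
  maximum on the right is attained at the same vector in every summand. Without it, sums of
  signed seminorms need not be signed seminorms.
\<close>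

lemma signed_seminorm_comonotone_sum:
  assumes X: "\<And>i. i \<in> I \<Longrightarrow> signed_seminorm (X i)" and c: "\<And>i. i \<in> I \<Longrightarrow> 0 \<le> c i"
    and comon: "\<And>i j v w. i \<in> I \<Longrightarrow> j \<in> I \<Longrightarrow> X i v < X i w \<Longrightarrow> X j v \<le> X j w"
  shows "signed_seminorm (\<lambda>v. \<Sum>i\<in>I. c i * X i v)"
proof (rule signed_seminormI)
  show "(\<Sum>i\<in>I. c i * X i (a *\<^sub>R v)) = sgn a * (\<Sum>i\<in>I. c i * X i v)" for a v
    unfolding sum_distrib_left
    by (rule sum.cong) (simp_all add: signed_seminorm_scaleR[OF X])
  show "(\<Sum>i\<in>I. c i * X i (v + w)) \<le> max (\<Sum>i\<in>I. c i * X i v) (\<Sum>i\<in>I. c i * X i w)" for v w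
  proof -
    consider "\<forall>i\<in>I. X i v \<le> X i w" | "\<forall>i\<in>I. X i w \<le> X i v"
      using comon by (meson linorder_not_le)
    then show ?thesis
    proof cases
      case 1
      then have "X i (v + w) \<le> X i w" if "i \<in> I" for i
        using signed_seminorm_add_le[OF X[OF that], of v w] that by (simp add: max_absorb2)
      then have "(\<Sum>i\<in>I. c i * X i (v + w)) \<le> (\<Sum>i\<in>I. c i * X i w)"
        by (intro sum_mono mult_left_mono c)
      then show ?thesis by simp
    next
      case 2
      then have "X i (v + w) \<le> X i v" if "i \<in> I" for i
        using signed_seminorm_add_le[OF X[OF that], of v w] that by (simp add: max_absorb1)
      then have "(\<Sum>i\<in>I. c i * X i (v + w)) \<le> (\<Sum>i\<in>I. c i * X i v)"
        by (intro sum_mono mult_left_mono c)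
      then show ?thesis by simp
    qed
  qed
qed

text \<open>
  The critical case is \<open>C (v + w) = 0\<close>. Since \<open>v = (v + w) - w\<close>, the values \<open>C v\<close> and \<open>C w\<close> are then
  opposite: either one of them is \<open>1\<close> and the maximum is \<open>1\<close>, or both vanish and \<open>D\<close> decides at all
  three vectors.
\<close>

lemma signed_seminorm_sign_comp:
  assumes C: "signed_seminorm C" "range C \<subseteq> {-1, 0, 1}"
    and D: "signed_seminorm D" "range D \<subseteq> {-1, 0, 1}"
  shows "signed_seminorm (sign_comp C D)"
proof (rule signed_seminormI)
  show "sign_comp C D (a *\<^sub>R v) = sgn a * sign_comp C D v" for a v
    by (auto simp: sign_comp_def signed_seminorm_scaleR C D sgn_if)
  show "sign_comp C D (v + w) \<le> max (sign_comp C D v) (sign_comp C D w)" for v w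
  proof -
    have C_vals: "C u = -1 \<or> C u = 0 \<or> C u = 1" for u
      using C(2) by blast
    have D_vals: "D u = -1 \<or> D u = 0 \<or> D u = 1" for u
      using D(2) by blast
    have D_bounds: "-1 \<le> D u" "D u \<le> 1" for u
      using D_vals[of u] by auto
    have C_add: "C (v + w) \<le> max (C v) (C w)"
      and D_add: "D (v + w) \<le> max (D v) (D w)"
      by (simp_all add: signed_seminorm_add_le C D)
    have C_diff: "min (C (v + w)) (- C w) \<le> C v" "min (C (v + w)) (- C v) \<le> C w"
      using signed_seminorm_add_ge[OF C(1), of "v + w" "- w"]
        signed_seminorm_add_ge[OF C(1), of "v + w" "- v"]
      by (simp_all add: signed_seminorm_minus[OF C(1)])
    consider "C (v + w) = -1" | "C (v + w) = 1" | "C (v + w) = 0"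
      using C_vals by blast
    then show ?thesis
    proof cases
      case 1
      then show ?thesis
        using C_vals[of v] D_bounds(1)[of v] by (auto simp: sign_comp_def le_max_iff_disj)
    next
      case 2
      then have "C v = 1 \<or> C w = 1"
        using C_add C_vals[of v] C_vals[of w] by auto
      with 2 show ?thesis
        by (auto simp: sign_comp_def)
    next
      case 3
      then have "C v = 0 \<and> C w = 0 \<or> C v = 1 \<or> C w = 1"
        using 3 C_diff C_vals[of v] C_vals[of w] by auto
      with 3 show ?thesis
        using D_add D_bounds(2)[of "v + w"] by (auto simp: sign_comp_def le_max_iff_disj)
    qed
  qed
qed

text \<open>
  The sets \<open>{v. \<bar>s v\<bar> \<le> t}\<close> form a flag of subspaces that jumps at every value of \<open>\<bar>s\<bar>\<close>.
\<close>

lemma signed_seminorm_less_imp_dim_less: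
  fixes s :: "'a::euclidean_space \<Rightarrow> real"
  assumes s: "signed_seminorm s" and "\<bar>s w\<bar> > t" "t \<ge> 0"
  shows "dim {v. \<bar>s v\<bar> \<le> t} < dim {v. \<bar>s v\<bar> \<le> \<bar>s w\<bar>}"
proof -
  have sub: "subspace {v. \<bar>s v\<bar> \<le> r}" if "r \<ge> 0" for r
    unfolding subspace_def
  proof (safe)
    show "\<bar>s 0\<bar> \<le> r"
      using that by (simp add: signed_seminorm_zero[OF s])
    show "\<bar>s (v + u)\<bar> \<le> r" if "\<bar>s v\<bar> \<le> r" "\<bar>s u\<bar> \<le> r" for v u
      using that signed_seminorm_add_le[OF s, of v u] signed_seminorm_add_ge[OF s, of v u] by linarith
    show "\<bar>s (c *\<^sub>R v)\<bar> \<le> r" if "\<bar>s v\<bar> \<le> r" for c v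
      using that \<open>r \<ge> 0\<close> by (auto simp: signed_seminorm_scaleR[OF s] abs_mult sgn_if)
  qed
  show ?thesis
  proof (rule dim_psubset)
    have "{v. \<bar>s v\<bar> \<le> t} \<subset> {v. \<bar>s v\<bar> \<le> \<bar>s w\<bar>}"
    proof (rule psubsetI)
      have "w \<in> {v. \<bar>s v\<bar> \<le> \<bar>s w\<bar>}" "w \<notin> {v. \<bar>s v\<bar> \<le> t}"
        using assms(2) by simp_all
      then show "{v. \<bar>s v\<bar> \<le> t} \<noteq> {v. \<bar>s v\<bar> \<le> \<bar>s w\<bar>}"
        by blast
    qed (use assms(2) in auto)
    then show "span {v. \<bar>s v\<bar> \<le> t} \<subset> span {v. \<bar>s v\<bar> \<le> \<bar>s w\<bar>}"
      using sub[OF \<open>t \<ge> 0\<close>] sub[of "\<bar>s w\<bar>"] by (simp add: span_eq_iff[THEN iffD2])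
  qed
qed

lemma finite_range_abs_signed_seminorm:
  fixes s :: "'a::euclidean_space \<Rightarrow> real"
  assumes s: "signed_seminorm s"
  shows "finite (range (\<lambda>v. \<bar>s v\<bar>))"
proof (rule finite_imageD)
  let ?d = "\<lambda>t. dim {v. \<bar>s v\<bar> \<le> t}"
  show "finite (?d ` range (\<lambda>v. \<bar>s v\<bar>))"
    by (rule finite_subset[of _ "{..DIM('a)}"]) (auto intro: dim_subset_UNIV)
  have "strict_mono_on (range (\<lambda>v. \<bar>s v\<bar>)) ?d"
    using signed_seminorm_less_imp_dim_less[OF s] by (auto simp: strict_mono_on_def)
  then show "inj_on ?d (range (\<lambda>v. \<bar>s v\<bar>))"
    by (rule strict_mono_on_imp_inj_on)
qed

section \<open>Sign-valued seminorms as lexicographic signs\<close>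

text \<open>
  Induction on \<open>dim U\<close>. Separating the convex set \<open>P = {u \<in> U. X u > 0}\<close> from \<open>0\<close> gives \<open>a \<in> span P\<close>
  with \<open>a \<bullet> x \<ge> 0\<close> on \<open>P\<close>; taking \<open>a\<close> in the span, not just nonzero, ensures \<open>a \<in> U\<close>, so that
  \<open>U \<inter> a\<^sup>\<bottom>\<close> has smaller dimension. Adding a zero of \<open>X\<close> to an element of \<open>P\<close> stays in \<open>P\<close>, which
  forces \<open>X\<close> to be nonzero off \<open>a\<^sup>\<bottom>\<close>; hence \<open>X u = sgn (a \<bullet> u)\<close> there.
\<close>

lemma sign_valued_seminorm_lexicographic_on:
  fixes X :: "'a::euclidean_space \<Rightarrow> real"
  assumes X: "signed_seminorm X" "range X \<subseteq> {-1, 0, 1}" and "subspace U"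
  shows "\<exists>as. 0 \<notin> set as \<and>
    (\<forall>u\<in>U. foldr sign_comp (map (\<lambda>a u. sgn (a \<bullet> u)) as) (\<lambda>_. 0) u = X u)"
  using \<open>subspace U\<close>
proof (induction "dim U" arbitrary: U rule: less_induct)
  case less
  have vals: "X u = -1 \<or> X u = 0 \<or> X u = 1" for u
    using X(2) by blast
  show ?case
  proof (cases "\<forall>u\<in>U. X u = 0")
    case True
    then show ?thesis
      by (intro exI[of _ "[]"]) simp
  next
    case False
    define P where "P = {u \<in> U. X u > 0}"
    have add_P: "X (v + w) > 0" if "X v > 0" "X w \<ge> 0" for v w
    proof -
      have "X v \<le> max (X (v + w)) (- X w)"
        using signed_seminorm_add_le[OF X(1), of "v + w" "- w"]
        by (simp add: signed_seminorm_minus[OF X(1)])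
      then show ?thesis
        using that by linarith
    qed
    obtain p where p: "p \<in> P"
    proof -
      obtain u where u: "u \<in> U" "X u \<noteq> 0"
        using False by blast
      show thesis
        using that[of u] that[of "- u"] u subspace_neg[OF less.prems u(1)]
        by (cases "X u > 0") (auto simp: P_def signed_seminorm_minus[OF X(1)])
    qed
    have "convex P"
    proof (rule convexI)
      fix x y u v assume *: "x \<in> P" "y \<in> P" "0 \<le> (u::real)" "0 \<le> v" "u + v = 1"
      then have "u > 0 \<or> v > 0" by linarith
      then have "X (u *\<^sub>R x + v *\<^sub>R y) > 0"
        using * add_P[of "u *\<^sub>R x" "v *\<^sub>R y"] add_P[of "v *\<^sub>R y" "u *\<^sub>R x"]
        by (auto simp: P_def signed_seminorm_scaleR[OF X(1)] sgn_if add.commute)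
      then show "u *\<^sub>R x + v *\<^sub>R y \<in> P"
        using * less.prems by (simp add: P_def subspace_add subspace_scale)
    qed
    moreover have "P \<noteq> {}" "0 \<notin> P"
      using p by (auto simp: P_def signed_seminorm_zero[OF X(1)])
    ultimately obtain a where a: "a \<in> span P" "a \<noteq> 0" "\<And>x. x \<in> P \<Longrightarrow> 0 \<le> a \<bullet> x"
      by (rule separating_hyperplane_set_0_inspan) blast
    have "a \<in> U"
      using a(1) span_minimal[OF _ less.prems, of P] by (auto simp: P_def)
    have pos: "X u = 1" if u: "u \<in> U" "a \<bullet> u > 0" for u
    proof (rule ccontr)
      assume "X u \<noteq> 1"
      then consider "X u = 0" | "X u = -1"
        using vals by blast
      then show False
      proof cases
        case 1
        (* The line through p in direction u lies in P, but a is negative somewhere on it: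
           t is chosen so that the value there is -1. *)
        define t where "t = - (a \<bullet> p + 1) / (a \<bullet> u)"
        have "p + t *\<^sub>R u \<in> P"
          using p u(1) 1 add_P[of p "t *\<^sub>R u"] less.prems
          by (simp add: P_def signed_seminorm_scaleR[OF X(1)] subspace_add subspace_scale)
        then have "0 \<le> a \<bullet> p + t * (a \<bullet> u)"
          using a(3) by (fastforce simp: inner_add_right)
        then show False
          using u(2) by (simp add: t_def)
      next
        case 2
        then have "- u \<in> P"
          using u(1) less.prems by (simp add: P_def signed_seminorm_minus[OF X(1)] subspace_neg)
        then show False
          using a(3)[of "- u"] u(2) by simp
      qed
    qed
    have neg: "X u = -1" if "u \<in> U" "a \<bullet> u < 0" for u
      using pos[of "- u"] that less.prems by (simp add: subspace_neg signed_seminorm_minus[OF X(1)])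
    define U' where "U' = U \<inter> {u. a \<bullet> u = 0}"
    have "subspace U'"
      unfolding U'_def by (intro subspace_inter less.prems subspace_hyperplane)
    moreover have "dim U' < dim U"
    proof (rule dim_psubset)
      have "a \<notin> U'"
        using a(2) by (simp add: U'_def)
      then have "U' \<subset> U"
        using \<open>a \<in> U\<close> unfolding U'_def by blast
      then show "span U' \<subset> span U"
        using \<open>subspace U'\<close> less.prems by (simp add: span_eq_iff[THEN iffD2])
    qed
    ultimately obtain as where as: "0 \<notin> set as"
      "\<forall>u\<in>U'. foldr sign_comp (map (\<lambda>a u. sgn (a \<bullet> u)) as) (\<lambda>_. 0) u = X u"
      using less.hyps by blast
    show ?thesis
    proof (intro exI[of _ "a # as"] conjI ballI)
      show "0 \<notin> set (a # as)"
        using a(2) as(1) by simp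
      show "foldr sign_comp (map (\<lambda>a u. sgn (a \<bullet> u)) (a # as)) (\<lambda>_. 0) u = X u" if "u \<in> U" for u
        using as(2) pos[OF that] neg[OF that] that
        by (cases "a \<bullet> u" "0::real" rule: linorder_cases) (auto simp: sign_comp_def U'_def)
    qed
  qed
qed

section \<open>Covectors of the universal oriented matroid\<close>

definition dual_coords :: "'n::finite dual \<Rightarrow> real ^ 'n" where
  "dual_coords e = (\<chi> i. blinfun_apply e (axis i 1))"

lemma linear_dual_coords: "linear dual_coords"
  by (rule linearI)
    (simp_all add: dual_coords_def vec_eq_iff blinfun.add_left blinfun.scaleR_left)

lemma dual_coords_inner_right [simp]: "dual_coords (blinfun_inner_right y) = y"
  by (simp add: dual_coords_def vec_eq_iff inner_axis)

lemma inner_right_dual_coords [simp]: "blinfun_inner_right (dual_coords e) = (e :: 'n::finite dual)"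
proof (rule blinfun_eqI)
  fix x :: "real ^ 'n"
  have "blinfun_apply e x = blinfun_apply e (\<Sum>i\<in>UNIV. (x $ i) *\<^sub>R axis i 1)"
    by (simp add: basis_expansion flip: scalar_mult_eq_scaleR)
  also have "\<dots> = dual_coords e \<bullet> x"
    by (simp add: blinfun.sum_right blinfun.scaleR_right dual_coords_def inner_vec_def mult.commute)
  finally show "blinfun_apply (blinfun_inner_right (dual_coords e)) x = blinfun_apply e x"
    by simp
qed

text \<open>
  Row form of the chirotope, in which the multilinearity lemmas for determinants apply.
\<close>

lemma universal_chirotope_update:
  "universal_chirotope (\<mu>(k := e)) =
     sgn (det (\<chi> i. if i = k then dual_coords e else dual_coords (\<mu> i)))"
proof -
  have "(\<chi> i j. blinfun_apply ((\<mu>(k := e)) j) (axis i 1)) =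
      transpose (\<chi> i. if i = k then dual_coords e else dual_coords (\<mu> i))"
    by (simp add: vec_eq_iff transpose_def dual_coords_def)
  then show ?thesis
    by (simp add: universal_chirotope_def)
qed

lemma signed_seminorm_universal_chirotope: "signed_seminorm (\<lambda>e. universal_chirotope (\<mu>(k := e)))"
proof -
  let ?g = "\<lambda>e. det (\<chi> i. if i = k then dual_coords e else dual_coords (\<mu> i))"
  have "linear ?g"
    using det_row_add[of k "\<lambda>_. dual_coords _" "\<lambda>_. dual_coords _" "\<lambda>i. dual_coords (\<mu> i)"]
      det_row_mul[of k _ "\<lambda>_. dual_coords _" "\<lambda>i. dual_coords (\<mu> i)"]
    by (intro linearI)
      (simp_all add: linear_add[OF linear_dual_coords] linear_cmul[OF linear_dual_coords]
        scalar_mult_eq_scaleR cong: if_cong)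
  then show ?thesis
    unfolding universal_chirotope_update
    by (rule signed_seminorm_compose_linear[OF signed_seminorm_sgn])
qed

lemma signed_cocircuit_sign_valued_seminorm:
  assumes "C \<in> signed_cocircuits universal_chirotope"
  shows "signed_seminorm C \<and> range C \<subseteq> {-1, 0, 1}"
proof -
  obtain \<mu> where C: "C = (\<lambda>e. universal_chirotope (\<mu>(Max UNIV := e))) \<or>
      C = (\<lambda>e. - universal_chirotope (\<mu>(Max UNIV := e)))"
    using assms unfolding signed_cocircuits_def by blast
  have "signed_seminorm C"
    using C signed_seminorm_universal_chirotope[of \<mu> "Max UNIV"]
      signed_seminorm_scale[OF signed_seminorm_universal_chirotope[of \<mu> "Max UNIV"], of "-1"]
    by auto
  moreover have "C e = -1 \<or> C e = 0 \<or> C e = 1" for e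
    using C sgn_real_values[of "det (\<chi> i j. blinfun_apply ((\<mu>(Max UNIV := e)) j) (axis i 1))"]
    unfolding universal_chirotope_def by fastforce
  ultimately show ?thesis
    by blast
qed

lemma covector_sign_valued_seminorm:
  assumes "X \<in> covectors universal_chirotope"
  shows "signed_seminorm X" "range X \<subseteq> {-1, 0, 1}"
proof -
  obtain Cs where Cs: "X = foldr sign_comp Cs (\<lambda>_. 0)" "set Cs \<subseteq> signed_cocircuits universal_chirotope"
    using assms unfolding covectors_def by blast
  have "signed_seminorm X \<and> range X \<subseteq> {-1, 0, 1}"
    using Cs(2) unfolding Cs(1)
  proof (induction Cs)
    case Nil
    show ?case by (auto intro: signed_seminormI)
  next
    case (Cons C Cs)
    then have C: "signed_seminorm C" "range C \<subseteq> {-1, 0, 1}"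
      and Cs: "signed_seminorm (foldr sign_comp Cs (\<lambda>_. 0))"
        "range (foldr sign_comp Cs (\<lambda>_. 0)) \<subseteq> {-1, 0, 1}"
      using signed_cocircuit_sign_valued_seminorm by auto
    from C(2) Cs(2) have "range (sign_comp C (foldr sign_comp Cs (\<lambda>_. 0))) \<subseteq> {-1, 0, 1}"
      unfolding sign_comp_def by fastforce
    then show ?case
      using signed_seminorm_sign_comp[OF C Cs] by simp
  qed
  then show "signed_seminorm X" "range X \<subseteq> {-1, 0, 1}"
    by auto
qed

text \<open>
  Let the columns of an orthogonal matrix \<open>A\<close> be the functionals \<open>\<mu>\<close>, with the normalised \<open>a\<close> in the
  distinguished position \<open>k\<close>. Replacing that column by \<open>e\<close> multiplies the determinant, by Cramer's
  rule, by the \<open>k\<close>-th coordinate of the solution \<open>y\<close> of \<open>A y = e\<close>, which is \<open>(a \<bullet> e) / norm a\<close> as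
  \<open>A\<close> is orthogonal. The factor \<open>det A = \<plusminus>1\<close> is absorbed by the sign in the notion of cocircuit.
\<close>

lemma sgn_inner_signed_cocircuit:
  fixes a :: "real ^ 'n::{finite,linorder}"
  assumes "a \<noteq> 0"
  shows "(\<lambda>e. sgn (a \<bullet> dual_coords e)) \<in> signed_cocircuits universal_chirotope"
proof -
  define k :: 'n where "k = Max UNIV"
  obtain A where A: "orthogonal_matrix A" "A *v axis k 1 = a /\<^sub>R norm a"
    using orthogonal_matrix_exists_basis[of "a /\<^sub>R norm a" k] assms by auto
  define \<mu> where "\<mu> j = blinfun_inner_right (column j A)" for j
  have *: "universal_chirotope (\<mu>(k := e)) = sgn (a \<bullet> dual_coords e) * sgn (det A)" for e
  proof -
    define y where "y = transpose A *v dual_coords e"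
    have Ay: "A *v y = dual_coords e"
      using A(1) unfolding y_def matrix_vector_mul_assoc by (simp add: orthogonal_matrix_def)
    have "y $ k = y \<bullet> axis k 1"
      by (simp add: inner_axis)
    also have "\<dots> = dual_coords e \<bullet> (A *v axis k 1)"
      by (simp add: y_def dot_lmul_matrix)
    also have "\<dots> = (a \<bullet> dual_coords e) / norm a"
      by (simp add: A(2) inner_commute divide_inverse mult.commute)
    finally have yk: "y $ k = (a \<bullet> dual_coords e) / norm a" .
    have "(\<chi> i. if i = k then dual_coords e else dual_coords (\<mu> i)) =
        transpose (\<chi> i j. if j = k then (A *v y) $ i else A $ i $ j)"
      unfolding Ay by (simp add: vec_eq_iff transpose_def \<mu>_def column_def)
    then have "universal_chirotope (\<mu>(k := e)) = sgn (y $ k * det A)"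
      by (simp only: universal_chirotope_update det_transpose cramer_lemma)
    then show ?thesis
      using assms by (simp add: yk sgn_mult sgn_divide)
  qed
  have "det A = 1 \<or> det A = -1"
    using A(1) by (rule det_orthogonal_matrix)
  then have "(\<lambda>e. sgn (a \<bullet> dual_coords e)) = (\<lambda>e. universal_chirotope (\<mu>(k := e))) \<or>
      (\<lambda>e. sgn (a \<bullet> dual_coords e)) = (\<lambda>e. - universal_chirotope (\<mu>(k := e)))"
    by (auto simp: *)
  moreover have "(\<lambda>e. sgn (a \<bullet> dual_coords e)) \<noteq> (\<lambda>_. 0)"
  proof
    assume "(\<lambda>e. sgn (a \<bullet> dual_coords e)) = (\<lambda>_. 0)"
    from fun_cong[OF this, of "blinfun_inner_right a"] show False
      using assms by (simp add: sgn_if)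
  qed
  ultimately show ?thesis
    unfolding signed_cocircuits_def k_def by blast
qed

lemma sign_valued_seminorm_covector:
  fixes X :: "'n::{finite,linorder} dual \<Rightarrow> real"
  assumes X: "signed_seminorm X" "range X \<subseteq> {-1, 0, 1}"
  shows "X \<in> covectors universal_chirotope"
proof -
  let ?Y = "\<lambda>y. X (blinfun_inner_right y)"
  have "signed_seminorm ?Y"
    using X(1) by (rule signed_seminorm_compose_linear)
      (rule bounded_linear.linear[OF bounded_linear_blinfun_inner_right])
  moreover have "range ?Y \<subseteq> {-1, 0, 1}"
    using X(2) by blast
  ultimately obtain as where as: "0 \<notin> set as"
    and lex: "\<And>u. foldr sign_comp (map (\<lambda>a u. sgn (a \<bullet> u)) as) (\<lambda>_. 0) u = ?Y u"
    using sign_valued_seminorm_lexicographic_on[of ?Y UNIV] by auto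
  have comp: "foldr sign_comp (map (\<lambda>a e. sgn (a \<bullet> dual_coords e)) as) (\<lambda>_. 0) e =
      foldr sign_comp (map (\<lambda>a u. sgn (a \<bullet> u)) as) (\<lambda>_. 0) (dual_coords e)"
    for as and e :: "'n dual"
    by (induction as) (simp_all add: sign_comp_def)
  have "X = foldr sign_comp (map (\<lambda>a e. sgn (a \<bullet> dual_coords e)) as) (\<lambda>_. 0)"
    by (simp add: fun_eq_iff comp lex)
  moreover have "set (map (\<lambda>a e. sgn (a \<bullet> dual_coords e)) as) \<subseteq> signed_cocircuits universal_chirotope"
  proof -
    have "(\<lambda>e :: 'n dual. sgn (a \<bullet> dual_coords e)) \<in> signed_cocircuits universal_chirotope"
      if "a \<in> set as" for a
      by (rule sgn_inner_signed_cocircuit) (use that as in auto)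
    then show ?thesis
      by auto
  qed
  ultimately show ?thesis
    unfolding covectors_def by blast
qed

section \<open>Cones over chains of covectors\<close>

text \<open>
  Let \<open>X\<close> precede \<open>Y\<close> in the sign order. If \<open>X v < X w\<close>, then \<open>X v = -1\<close> or \<open>X w = 1\<close>; as \<open>Y\<close> agrees
  with \<open>X\<close> where \<open>X\<close> is nonzero, \<open>Y\<close> takes the same extreme value there, so \<open>Y v \<le> Y w\<close>. Thus chains are
  comonotone. At a point where the smallest covector is nonzero all of them agree, so the positive
  combination does not vanish.
\<close>

lemma open_cone_nonzero_signed_seminorm:
  assumes Xs: "Xs \<noteq> []" "set Xs \<subseteq> covectors universal_chirotope - {\<lambda>_. 0}"
    "sorted_wrt sign_less Xs" and x: "x \<in> open_cone Xs"
  shows "x \<in> nonzero_signed_seminorms"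
proof -
  obtain \<alpha> where \<alpha>: "\<And>i. i < length Xs \<Longrightarrow> \<alpha> i > 0" and
    x_eq: "x = (\<lambda>e. \<Sum>i<length Xs. \<alpha> i * (Xs ! i) e)"
    using x unfolding open_cone_def by blast
  have X: "signed_seminorm (Xs ! i)" "range (Xs ! i) \<subseteq> {-1, 0, 1}" if "i < length Xs" for i
    using covector_sign_valued_seminorm[of "Xs ! i"] Xs(2) nth_mem[OF that] by auto
  have vals: "(Xs ! i) e = -1 \<or> (Xs ! i) e = 0 \<or> (Xs ! i) e = 1" if "i < length Xs" for i e
    using X(2)[OF that] by blast
  have ext: "(Xs ! i) e = 0 \<or> (Xs ! i) e = (Xs ! j) e" if "i < j" "j < length Xs" for i j e
    using sorted_wrt_nth_less[OF Xs(3) that] by (simp add: sign_less_def)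
  have comon: "(Xs ! j) v \<le> (Xs ! j) w"
    if "i < length Xs" "j < length Xs" "(Xs ! i) v < (Xs ! i) w" for i j v w
  proof (cases i j rule: linorder_cases)
    case less
    show ?thesis
      using ext[OF less that(2), of v] ext[OF less that(2), of w] that(3)
        vals[OF that(1), of v] vals[OF that(1), of w] vals[OF that(2), of v] vals[OF that(2), of w]
      by auto
  next
    case greater
    show ?thesis
      using ext[OF greater that(1), of v] ext[OF greater that(1), of w] that(3)
        vals[OF that(1), of v] vals[OF that(1), of w] vals[OF that(2), of v] vals[OF that(2), of w]
      by auto
  qed (use that in auto)
  have "signed_seminorm x"
    unfolding x_eq
    by (rule signed_seminorm_comonotone_sum)
      (auto intro: X comon simp: less_imp_le[OF \<alpha>])
  moreover have "x \<noteq> (\<lambda>_. 0)"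
  proof -
    have "Xs ! 0 \<noteq> (\<lambda>_. 0)"
      using Xs(1,2) nth_mem[of 0 Xs] by (metis Diff_iff length_greater_0_conv singletonI subsetD)
    then obtain e where e: "(Xs ! 0) e \<noteq> 0"
      by auto
    have "(Xs ! i) e = (Xs ! 0) e" if "i < length Xs" for i
      using ext[of 0 i e] e that by (cases "i = 0") auto
    then have "x e = (\<Sum>i<length Xs. \<alpha> i) * (Xs ! 0) e"
      by (simp add: x_eq sum_distrib_right)
    moreover have "(\<Sum>i<length Xs. \<alpha> i) > 0"
      using Xs(1) \<alpha> by (intro sum_pos) auto
    ultimately have "x e \<noteq> 0"
      using e by simp
    then show ?thesis
      by auto
  qed
  ultimately show ?thesis
    by (simp add: nonzero_signed_seminorms_def)
qed

definition sgn_from :: "real \<Rightarrow> real \<Rightarrow> real" where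
  "sgn_from t r = (if t \<le> \<bar>r\<bar> then sgn r else 0)"

lemma signed_seminorm_sgn_from:
  assumes "signed_seminorm s" "t > 0"
  shows "signed_seminorm (\<lambda>v. sgn_from t (s v))"
  using assms(1)
proof (rule signed_seminorm_odd_mono)
  show "mono (sgn_from t)"
    using assms(2) by (auto simp: mono_def sgn_from_def sgn_if)
qed (auto simp: sgn_from_def sgn_if)

text \<open>
  As no \<open>d\<close>-value lies strictly between consecutive ones and \<open>\<bar>r\<bar>\<close> is a \<open>d\<close>-value, each summand is
  \<open>sgn r\<close> times the difference of the truncations \<open>min (d i) \<bar>r\<bar>\<close> and \<open>min (d (Suc i)) \<bar>r\<bar>\<close>.
\<close>

lemma sum_diff_sgn_from:
  fixes d :: "nat \<Rightarrow> real"
  assumes d: "\<And>i. i \<le> n \<Longrightarrow> d i \<ge> 0" "\<And>i. i < n \<Longrightarrow> d (Suc i) < d i" "d n = 0" and "\<bar>r\<bar> \<in> d ` {..n}"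
  shows "(\<Sum>i<n. (d i - d (Suc i)) * sgn_from (d i) r) = r"
proof -
  obtain j where j: "j \<le> n" "\<bar>r\<bar> = d j"
    using assms(4) by auto
  have anti: "d k \<le> d i" if "i \<le> k" "k \<le> n" for i k
    using that
  proof (induction k rule: dec_induct)
    case (step k)
    then show ?case
      using d(2)[of k] by simp
  qed simp
  have "(d i - d (Suc i)) * sgn_from (d i) r = sgn r * (min (d i) \<bar>r\<bar> - min (d (Suc i)) \<bar>r\<bar>)"
    if i: "i < n" for i
  proof (cases "j \<le> i")
    case True
    then show ?thesis
      using anti[of j i] anti[of j "Suc i"] i j by (simp add: sgn_from_def)
  next
    case False
    then have "\<bar>r\<bar> \<le> d (Suc i)" "d (Suc i) < d i"
      using anti[of "Suc i" j] d(2)[OF i] j by simp_all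
    then show ?thesis
      by (simp add: sgn_from_def)
  qed
  then have "(\<Sum>i<n. (d i - d (Suc i)) * sgn_from (d i) r) =
      sgn r * (\<Sum>i<n. min (d i) \<bar>r\<bar> - min (d (Suc i)) \<bar>r\<bar>)"
    by (simp add: sum_distrib_left)
  also have "\<dots> = sgn r * (min (d 0) \<bar>r\<bar> - min (d n) \<bar>r\<bar>)"
    using sum_lessThan_telescope'[of "\<lambda>i. min (d i) \<bar>r\<bar>" n] by simp
  also have "\<dots> = r"
  proof -
    have "min (d 0) \<bar>r\<bar> = \<bar>r\<bar>" "min (d n) \<bar>r\<bar> = 0"
      using anti[of 0 j] j d(3) by simp_all
    then show ?thesis
      by (simp add: sgn_mult_abs)
  qed
  finally show ?thesis .
qed

text \<open>
  The absolute values are listed in decreasing order because a larger threshold deletes more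
  entries and so gives a smaller covector.
\<close>

lemma nonzero_signed_seminorm_in_open_cone:
  fixes s :: "'n::{finite,linorder} dual \<Rightarrow> real"
  assumes "s \<in> nonzero_signed_seminorms"
  obtains Xs where "Xs \<noteq> []" "set Xs \<subseteq> covectors universal_chirotope - {\<lambda>_. 0}"
    "sorted_wrt sign_less Xs" "s \<in> open_cone Xs"
proof -
  have s: "signed_seminorm s" and nz: "s \<noteq> (\<lambda>_. 0)"
    using assms by (auto simp: nonzero_signed_seminorms_def)
  define A where "A = range (\<lambda>e. \<bar>s e\<bar>) - {0}"
  have "finite (range (\<lambda>y. \<bar>s (blinfun_inner_right y)\<bar>))"
    by (intro finite_range_abs_signed_seminorm signed_seminorm_compose_linear[OF s]
        bounded_linear.linear[OF bounded_linear_blinfun_inner_right])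
  moreover have "range (\<lambda>e. \<bar>s e\<bar>) = range (\<lambda>y. \<bar>s (blinfun_inner_right y)\<bar>)"
    by (auto simp: image_iff) (metis inner_right_dual_coords)
  ultimately have "finite A"
    by (simp add: A_def)
  define ts where "ts = rev (sorted_list_of_set A)"
  define n where "n = length ts"
  \<comment> \<open>The final value \<open>d n = 0\<close> closes the telescoping sum and covers the zeros of \<open>s\<close>.\<close>
  define d where "d i = (if i < n then ts ! i else 0)" for i
  have set_ts: "set ts = A"
    using \<open>finite A\<close> by (simp add: ts_def)
  have dA: "d i \<in> A" if "i < n" for i
    using that nth_mem[of i ts] by (simp add: d_def n_def set_ts)
  then have dpos: "d i > 0" if "i < n" for i
    using that by (force simp: A_def)
  have anti: "d j < d i" if "i < j" "j < n" for i j
  proof -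
    have "sorted_wrt (>) ts"
      by (simp add: ts_def sorted_wrt_rev)
    then show ?thesis
      using that sorted_wrt_nth_less[of "(>)" ts i j] by (simp add: d_def n_def)
  qed
  define X where "X i = (\<lambda>e. sgn_from (d i) (s e))" for i
  have in_d: "\<bar>s e\<bar> \<in> d ` {..n}" for e
  proof (cases "s e = 0")
    case True
    then show ?thesis
      by (auto simp: d_def intro!: image_eqI[of _ _ n])
  next
    case False
    then have "\<bar>s e\<bar> \<in> set ts"
      by (auto simp: set_ts A_def)
    then obtain i where "i < n" "ts ! i = \<bar>s e\<bar>"
      by (auto simp: in_set_conv_nth n_def)
    then show ?thesis
      by (intro image_eqI[of _ _ i]) (simp_all add: d_def)
  qed
  show thesis
  proof
    show "map X [0..<n] \<noteq> []"
    proof -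
      obtain e where "s e \<noteq> 0"
        using nz by auto
      then have "\<bar>s e\<bar> \<in> set ts"
        by (auto simp: set_ts A_def)
      then show ?thesis
        by (auto simp: n_def)
    qed
    show "set (map X [0..<n]) \<subseteq> covectors universal_chirotope - {\<lambda>_. 0}"
    proof
      fix Y assume "Y \<in> set (map X [0..<n])"
      then obtain i where i: "i < n" "Y = X i"
        by auto
      obtain e where "\<bar>s e\<bar> = d i"
        using dA[OF i(1)] by (auto simp: A_def)
      then have "X i e \<noteq> 0"
        using dpos[OF i(1)] by (auto simp: X_def sgn_from_def sgn_if)
      moreover have "X i \<in> covectors universal_chirotope"
        unfolding X_def
        by (intro sign_valued_seminorm_covector signed_seminorm_sgn_from[OF s dpos[OF i(1)]])
          (auto simp: sgn_from_def sgn_if)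
      ultimately show "Y \<in> covectors universal_chirotope - {\<lambda>_. 0}"
        using i(2) by auto
    qed
    have "sign_less (X i) (X j)" if ij: "i < j" "j < n" for i j
    proof -
      obtain e where e: "\<bar>s e\<bar> = d j"
        using dA[OF ij(2)] by (auto simp: A_def)
      then have "X i e \<noteq> X j e"
        using anti[OF ij] dpos[OF ij(2)] by (auto simp: X_def sgn_from_def sgn_if)
      then have "X i \<noteq> X j"
        by metis
      moreover have "X i v = 0 \<or> X i v = X j v" for v
        using anti[OF ij] by (simp add: X_def sgn_from_def)
      ultimately show ?thesis
        by (simp add: sign_less_def)
    qed
    then show "sorted_wrt sign_less (map X [0..<n])"
      by (simp add: sorted_wrt_iff_nth_less)
    have dn: "d n = 0"
      by (simp add: d_def)
    have step: "d (Suc i) < d i" if "i < n" for i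
      using that anti[of i "Suc i"] dpos[of i] by (cases "Suc i < n") (auto simp: d_def)
    have "d i \<ge> 0" if "i \<le> n" for i
      using that dpos[of i] dn by (cases "i = n") auto
    then have "s e = (\<Sum>i<n. (d i - d (Suc i)) * X i e)" for e
      unfolding X_def using sum_diff_sgn_from[of n d, OF _ step dn in_d[of e]] by simp
    then have "s = (\<lambda>e. \<Sum>i<length (map X [0..<n]). (d i - d (Suc i)) * (map X [0..<n] ! i) e)"
      by auto
    then show "s \<in> open_cone (map X [0..<n])"
      unfolding open_cone_def using step by (auto intro!: exI[of _ "\<lambda>i. d i - d (Suc i)"])
  qed
qed

lemma real_bergman_set_universal_chirotope:
  "real_bergman_set (universal_chirotope :: ('n::{finite,linorder} \<Rightarrow> 'n dual) \<Rightarrow> real) =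
     (\<lambda>x. scaling_rel nonzero_vectors `` {x}) ` nonzero_signed_seminorms"
proof -
  let ?\<phi> = "universal_chirotope :: ('n \<Rightarrow> 'n dual) \<Rightarrow> real"
  have "(\<Union>Xs \<in> {Xs. Xs \<noteq> [] \<and> set Xs \<subseteq> covectors ?\<phi> - {\<lambda>_. 0} \<and> sorted_wrt sign_less Xs}.
      open_cone Xs) = nonzero_signed_seminorms" (is "?L = _")
  proof
    show "?L \<subseteq> nonzero_signed_seminorms"
      using open_cone_nonzero_signed_seminorm by blast
    show "nonzero_signed_seminorms \<subseteq> ?L"
    proof
      fix s :: "'n dual \<Rightarrow> real" assume "s \<in> nonzero_signed_seminorms"
      then obtain Xs where "Xs \<noteq> []" "set Xs \<subseteq> covectors ?\<phi> - {\<lambda>_. 0}"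
        "sorted_wrt sign_less Xs" "s \<in> open_cone Xs"
        by (rule nonzero_signed_seminorm_in_open_cone)
      then show "s \<in> ?L"
        by (intro UN_I[of Xs] CollectI conjI)
    qed
  qed
  moreover have "real_bergman_set ?\<phi> = (\<lambda>x. scaling_rel nonzero_vectors `` {x}) ` ?L"
    unfolding real_bergman_set_def by (rule image_UN[symmetric])
  ultimately show ?thesis
    by (simp only:)
qed

section \<open>Projective quotients of saturated sets\<close>

lemma quotient_map_unique_codomain:
  assumes Y: "quotient_map X Y f" and Z: "quotient_map X Z f"
  shows "Y = Z"
proof -
  have iff: "openin V U \<longleftrightarrow> U \<subseteq> f ` topspace X \<and> openin X {x \<in> topspace X. f x \<in> U}"
    if V: "quotient_map X V f" for U V
  proof -
    have img: "f ` topspace X = topspace V"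
      and op: "\<And>U. U \<subseteq> topspace V \<Longrightarrow> openin X {x \<in> topspace X. f x \<in> U} \<longleftrightarrow> openin V U"
      using V unfolding quotient_map_def by auto
    show ?thesis
      unfolding img using op[of U] openin_subset[of V U] by blast
  qed
  show ?thesis
    unfolding topology_eq by (simp only: iff[OF Y] iff[OF Z] simp_thms)
qed

text \<open>
  The saturation of an open set \<open>W\<close> is the union of the preimages of \<open>W\<close> under the scalings by
  \<open>c \<noteq> 0\<close>, each of which is continuous.
\<close>

lemma open_map_scaling_class:
  "open_map (subtopology (powertop_real UNIV) nonzero_vectors) real_projective_space
     (\<lambda>x :: 'e \<Rightarrow> real. scaling_rel nonzero_vectors `` {x})"
proof -
  let ?N = "nonzero_vectors :: ('e \<Rightarrow> real) set"
  let ?T = "subtopology (powertop_real UNIV) ?N"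
  let ?q = "\<lambda>x :: 'e \<Rightarrow> real. scaling_rel ?N `` {x}"
  have top: "topspace ?T = ?N"
    by simp
  have cont: "continuous_map ?T ?T (\<lambda>x e. c * x e)" if "c \<noteq> 0" for c
  proof -
    have "continuous_map (powertop_real UNIV) (powertop_real UNIV) (\<lambda>(x :: 'e \<Rightarrow> real) e. c * x e)"
      unfolding continuous_map_componentwise_UNIV
      by (intro allI continuous_map_real_mult_left continuous_map_product_projection) simp
    then show ?thesis
      using that
      by (auto simp: continuous_map_in_subtopology nonzero_vectors_def fun_eq_iff
          intro: continuous_map_from_subtopology)
  qed
  show ?thesis
    unfolding open_map_def
  proof (intro allI impI)
    fix W assume W: "openin ?T W"
    then have WN: "W \<subseteq> ?N"
      using openin_subset top by blast
    have "{x \<in> ?N. ?q x \<in> ?q ` W} = (\<Union>c\<in>-{0}. {x \<in> topspace ?T. (\<lambda>e. c * x e) \<in> W})" (is "?A = ?B")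
    proof
      show "?A \<subseteq> ?B"
      proof
        fix x assume "x \<in> ?A"
        then obtain y where y: "x \<in> ?N" "y \<in> W" "?q x = ?q y"
          by auto
        then have "(x, y) \<in> scaling_rel ?N"
          using WN by (simp add: eq_equiv_class_iff[OF equiv_scaling_rel] subsetD)
        then show "x \<in> ?B"
          using y by (auto simp: scaling_rel_def)
      qed
      show "?B \<subseteq> ?A"
      proof
        fix x assume "x \<in> ?B"
        then obtain c where c: "c \<noteq> 0" "x \<in> ?N" "(\<lambda>e. c * x e) \<in> W"
          by auto
        then have "(x, \<lambda>e. c * x e) \<in> scaling_rel ?N"
          using WN by (auto simp: scaling_rel_def)
        then have "?q x = ?q (\<lambda>e. c * x e)"
          by (rule equiv_class_eq[OF equiv_scaling_rel])
        then show "x \<in> ?A"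
          using c by auto
      qed
    qed
    moreover have "openin ?T ?B"
      using openin_continuous_map_preimage[OF cont W] by (intro openin_Union) auto
    moreover have "?q ` W \<subseteq> ?N // scaling_rel ?N"
      using WN by (auto intro: quotientI)
    ultimately show "openin real_projective_space (?q ` W)"
      unfolding real_projective_space_def openin_quotient_topology top by simp
  qed
qed

text \<open>
  Subspaces of quotients are in general not quotients of subspaces. Here they are, because an open
  projection stays open when restricted to a saturated set. Saturation also makes the classes
  formed inside \<open>S\<close> literally equal to those formed among all nonzero vectors, so that the two
  topologies are equal and not just homeomorphic.
\<close>

lemma quotient_topology_scaling_saturated:
  fixes S :: "('e \<Rightarrow> real) set"
  assumes S: "S \<subseteq> nonzero_vectors" and sat: "\<And>x c. x \<in> S \<Longrightarrow> c \<noteq> 0 \<Longrightarrow> (\<lambda>e. c * x e) \<in> S"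
  shows "quotient_topology (subtopology (powertop_real UNIV) S) (scaling_rel S) =
    subtopology real_projective_space ((\<lambda>x. scaling_rel nonzero_vectors `` {x}) ` S)"
proof -
  let ?T = "powertop_real UNIV :: ('e \<Rightarrow> real) topology"
  let ?N = "nonzero_vectors :: ('e \<Rightarrow> real) set"
  let ?q = "\<lambda>x :: 'e \<Rightarrow> real. scaling_rel ?N `` {x}"
  have class_eq: "scaling_rel S `` {x} = ?q x" if "x \<in> S" for x
    using that S sat by (auto simp: scaling_rel_def)
  have fibre: "{x \<in> topspace (subtopology ?T ?N). ?q x \<in> ?q ` S} = S"
  proof
    show "{x \<in> topspace (subtopology ?T ?N). ?q x \<in> ?q ` S} \<subseteq> S"
    proof
      fix x assume "x \<in> {x \<in> topspace (subtopology ?T ?N). ?q x \<in> ?q ` S}"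
      then obtain y where y: "x \<in> ?N" "y \<in> S" "?q y = ?q x"
        by auto
      then have "(y, x) \<in> scaling_rel ?N"
        using S by (simp add: eq_equiv_class_iff[OF equiv_scaling_rel] subsetD)
      then show "x \<in> S"
        using y(2) sat by (auto simp: scaling_rel_def)
    qed
  qed (use S in auto)
  have sub: "subtopology (subtopology ?T ?N) S = subtopology ?T S"
    using S by (simp add: subtopology_subtopology Int_absorb1)
  have "open_map (subtopology ?T S) (subtopology real_projective_space (?q ` S)) ?q"
    using open_map_restriction[OF open_map_scaling_class fibre] by (simp add: sub)
  moreover have "continuous_map (subtopology ?T ?N) real_projective_space ?q"
    unfolding real_projective_space_def
    by (intro quotient_imp_continuous_map quotient_map_quotient_topology)
  then have "continuous_map (subtopology ?T S) (subtopology real_projective_space (?q ` S)) ?q"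
    using continuous_map_from_subtopology[of "subtopology ?T ?N" _ ?q S]
    by (simp add: sub continuous_map_in_subtopology)
  moreover have "topspace (subtopology real_projective_space (?q ` S)) = ?q ` S"
    using S by (auto simp: real_projective_space_def topspace_quotient_topology intro!: quotientI)
  ultimately have q: "quotient_map (subtopology ?T S) (subtopology real_projective_space (?q ` S)) ?q"
    by (intro continuous_open_imp_quotient_map) simp_all
  have "quotient_map (subtopology ?T S)
      (quotient_topology (subtopology ?T S) (scaling_rel S)) (\<lambda>x. scaling_rel S `` {x})"
    by (rule quotient_map_quotient_topology)
  then have q': "quotient_map (subtopology ?T S)
      (quotient_topology (subtopology ?T S) (scaling_rel S)) ?q"
    by (rule quotient_map_eq) (simp add: class_eq)
  show ?thesis
    by (rule quotient_map_unique_codomain[OF q' q])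
qed

theorem theorem8p15:
  shows "(signed_goldman_iwahori_space :: ('n::{finite,linorder} dual \<Rightarrow> real) set topology)
    homeomorphic_space
    real_bergman_fan (universal_chirotope :: ('n \<Rightarrow> 'n dual) \<Rightarrow> real)"
proof -
  have "(signed_goldman_iwahori_space :: ('n dual \<Rightarrow> real) set topology) =
      subtopology real_projective_space
        ((\<lambda>x. scaling_rel nonzero_vectors `` {x}) ` nonzero_signed_seminorms)"
    unfolding signed_goldman_iwahori_space_def
  proof (rule quotient_topology_scaling_saturated)
    show "(nonzero_signed_seminorms :: ('n dual \<Rightarrow> real) set) \<subseteq> nonzero_vectors"
      by (auto simp: nonzero_signed_seminorms_def nonzero_vectors_def)
    show "(\<lambda>e. c * s e) \<in> nonzero_signed_seminorms"
      if "s \<in> nonzero_signed_seminorms" "c \<noteq> 0" for s :: "'n dual \<Rightarrow> real" and c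
      using that by (auto simp: nonzero_signed_seminorms_def signed_seminorm_scale fun_eq_iff)
  qed
  also have "\<dots> = real_bergman_fan (universal_chirotope :: ('n \<Rightarrow> 'n dual) \<Rightarrow> real)"
    unfolding real_bergman_fan_def real_bergman_set_universal_chirotope ..
  finally show ?thesis
    by (simp only: homeomorphic_space_refl)
qed

end
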